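(* Let $I,J\ge 2$ be integers, $a,b>0$, $h_x=a/I$, $h_y=b/J$. Let $\alpha_{i,j}>0$ ($0\le i\le I$, $0\le j\le J$) and $f_{i,j}\in\mathbb{R}$ ($1\le i\le I-1$, $1\le j\le J-1$) be given grid values. Consider the linear system for the unknowns $u_{i,j}$ ($0\le i\le I$, $0\le j\le J$) consisting of the following equations: (1) (interior five-point scheme) for all $1\le i\le I-1$, $1\le j\le J-1$, the equation $\mathrm{Int}_{i,j}(\epsilon)$ defined in the context; (2) (left boundary) $u_{0,j}-u_{1,j}=0$ for all $1\le j\le J-1$; (3) (right boundary) for all $1\le j\le J-1$, $$-\sum_{i=1}^{I-1}\frac{1}{h_y}\Big(\frac{\alpha_{i,j+1}+\alpha_{i,j}}{2}\,\frac{u_{i,j+1}-u_{i,j}}{h_y}-\frac{\alpha_{i,j}+\alpha_{i,j-1}}{2}\,\frac{u_{i,j}-u_{i,j-1}}{h_y}\Big)=\sum_{i=1}^{I-1}f_{i,j};$$ (4) (Dirichlet condition on bottom and top) $u_{i,0}=u_{i,J}=0$ for all $0\le i\le I$. Then this linear system has exactly one solution for every $\epsilon\ge 0$, that is, both for every choice of positive grid values $\epsilon=(\epsilon_{i,j})_{0\le i\le I,\,0\le j\le J}$ with all $\epsilon_{i,j}>0$, and for the limiting case $\epsilon=0$.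
   Context: The system is a finite difference discretization, on the uniform grid $(x_i,y_j)=(ih_x,jh_y)$ of $[0,a]\times[0,b]$, of the anisotropic diffusion problem $-\partial_x(\epsilon^{-1}\partial_x u)-\partial_y(\alpha\,\partial_y u)=f$ with Neumann condition $\partial_x u=0$ on the left and right sides and $u=0$ on the bottom and top sides. The right Neumann condition is replaced by the integrated equation $-\int_0^a\partial_y(\alpha\partial_y u)\,dx=\int_0^a f\,dx$. The coefficients $\epsilon$ and $\alpha$ may depend on $(x,y)$, and $\epsilon_{i,j},\alpha_{i,j},f_{i,j}$ denote grid values. Definition of $\mathrm{Int}_{i,j}(\epsilon)$. If all $\epsilon_{i,j}>0$, $\mathrm{Int}_{i,j}(\epsilon)$ is the equation $$-\frac{1}{h_x}\Big(\frac12\big(\tfrac{1}{\epsilon_{i+1,j}}+\tfrac{1}{\epsilon_{i,j}}\big)\frac{u_{i+1,j}-u_{i,j}}{h_x}-\frac12\big(\tfrac{1}{\epsilon_{i,j}}+\tfrac{1}{\epsilon_{i-1,j}}\big)\frac{u_{i,j}-u_{i-1,j}}{h_x}\Big)-\frac{1}{h_y}\Big(\frac{\alpha_{i,j+1}+\alpha_{i,j}}{2}\frac{u_{i,j+1}-u_{i,j}}{h_y}-\frac{\alpha_{i,j}+\alpha_{i,j-1}}{2}\frac{u_{i,j}-u_{i,j-1}}{h_y}\Big)=f_{i,j}.$$ In the limiting case $\epsilon=0$, $\mathrm{Int}_{i,j}(0)$ is the leading-order limit of this equation as $\epsilon\to0$, namely $$u_{i+1,j}-u_{i,j}=u_{i,j}-u_{i-1,j}.$$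 *)

theory Defs
  imports Complex_Main "HOL-Library.FuncSet"
begin

text \<open>
  Unknowns are real values on the grid \<open>{0..I} \<times> {0..J}\<close>.  Grid functions are made
  extensional (\<open>undefined\<close> off the grid), so that uniqueness is about grid values only.
\<close>

definition grid_funs :: "nat \<Rightarrow> nat \<Rightarrow> (nat \<Rightarrow> nat \<Rightarrow> real) set" where
  "grid_funs I J = ({0..I} \<rightarrow>\<^sub>E ({0..J} \<rightarrow>\<^sub>E UNIV))"

text \<open>
  The discretisations of \<open>\<partial>\<^sub>x(\<epsilon>\<^sup>-\<^sup>1 \<partial>\<^sub>x u)\<close> and \<open>\<partial>\<^sub>y(\<alpha> \<partial>\<^sub>y u)\<close> at \<open>(i, j)\<close>.  They are used only
  for \<open>i \<ge> 1\<close> and \<open>j \<ge> 1\<close> respectively, so the natural-number subtractions do not truncate.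
\<close>

definition diff_x ::
  "real \<Rightarrow> (nat \<Rightarrow> nat \<Rightarrow> real) \<Rightarrow> (nat \<Rightarrow> nat \<Rightarrow> real) \<Rightarrow> nat \<Rightarrow> nat \<Rightarrow> real" where
  "diff_x hx \<epsilon> u i j =
     1 / hx * (1 / 2 * (1 / \<epsilon> (i + 1) j + 1 / \<epsilon> i j) * ((u (i + 1) j - u i j) / hx)
             - 1 / 2 * (1 / \<epsilon> i j + 1 / \<epsilon> (i - 1) j) * ((u i j - u (i - 1) j) / hx))"

definition diff_y ::
  "real \<Rightarrow> (nat \<Rightarrow> nat \<Rightarrow> real) \<Rightarrow> (nat \<Rightarrow> nat \<Rightarrow> real) \<Rightarrow> nat \<Rightarrow> nat \<Rightarrow> real" where
  "diff_y hy \<alpha> u i j =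
     1 / hy * ((\<alpha> i (j + 1) + \<alpha> i j) / 2 * ((u i (j + 1) - u i j) / hy)
             - (\<alpha> i j + \<alpha> i (j - 1)) / 2 * ((u i j - u i (j - 1)) / hy))"

text \<open>
  The equation \<open>Int\<^sub>i\<^sub>,\<^sub>j(\<epsilon>)\<close> for positive \<open>\<epsilon>\<close>, and the equation \<open>Int\<^sub>i\<^sub>,\<^sub>j(0)\<close>, which is its
  leading-order limit as \<open>\<epsilon> \<rightarrow> 0\<close> and not the result of substituting \<open>\<epsilon> = 0\<close>.
\<close>

definition int_eq ::
  "real \<Rightarrow> real \<Rightarrow> (nat \<Rightarrow> nat \<Rightarrow> real) \<Rightarrow> (nat \<Rightarrow> nat \<Rightarrow> real) \<Rightarrow> (nat \<Rightarrow> nat \<Rightarrow> real)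
     \<Rightarrow> (nat \<Rightarrow> nat \<Rightarrow> real) \<Rightarrow> nat \<Rightarrow> nat \<Rightarrow> bool" where
  "int_eq hx hy \<alpha> f \<epsilon> u i j \<longleftrightarrow> - diff_x hx \<epsilon> u i j - diff_y hy \<alpha> u i j = f i j"

definition int_eq_zero :: "(nat \<Rightarrow> nat \<Rightarrow> real) \<Rightarrow> nat \<Rightarrow> nat \<Rightarrow> bool" where
  "int_eq_zero u i j \<longleftrightarrow> u (i + 1) j - u i j = u i j - u (i - 1) j"

text \<open>
  The full system; the parameter \<open>E\<close> is the interior equation, which is the only one in
  which \<open>\<epsilon>\<close> occurs.
\<close>

definition solves_system ::
  "nat \<Rightarrow> nat \<Rightarrow> real \<Rightarrow> (nat \<Rightarrow> nat \<Rightarrow> real) \<Rightarrow> (nat \<Rightarrow> nat \<Rightarrow> real)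
     \<Rightarrow> ((nat \<Rightarrow> nat \<Rightarrow> real) \<Rightarrow> nat \<Rightarrow> nat \<Rightarrow> bool) \<Rightarrow> (nat \<Rightarrow> nat \<Rightarrow> real) \<Rightarrow> bool" where
  "solves_system I J hy \<alpha> f E u \<longleftrightarrow>
     (\<forall>i\<in>{1..I-1}. \<forall>j\<in>{1..J-1}. E u i j) \<and>
     (\<forall>j\<in>{1..J-1}. u 0 j - u 1 j = 0) \<and>
     (\<forall>j\<in>{1..J-1}. - (\<Sum>i=1..I-1. diff_y hy \<alpha> u i j) = (\<Sum>i=1..I-1. f i j)) \<and>
     (\<forall>i\<in>{0..I}. u i 0 = 0 \<and> u i J = 0)"

end

theory Submission
  imports Defs
begin

text \<open>
  There is one equation per grid point, so the system is square and it suffices to show that the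
  homogeneous system has only the zero solution. For positive \<open>\<epsilon>\<close>, summing the interior equations
  along a row telescopes the \<open>x\<close>-fluxes; by the left boundary equation the first flux vanishes, and
  then the right boundary equation says exactly that the last flux vanishes as well. Testing the
  interior equations with \<open>u\<close> and summing by parts gives a vanishing sum of nonnegative energies.
  For \<open>\<epsilon> = 0\<close> the rows are affine, hence constant by the left boundary equation, and testing the
  right boundary equation with \<open>u\<close> gives a vanishing \<open>y\<close>-energy. In both cases every interior
  column is constant, hence zero by the Dirichlet condition.
\<close>

section \<open>Square linear systems\<close>

text \<open>Gaussian elimination by induction on the unknowns; keeping \<open>S\<close> and
  \<open>T\<close> separate lets each step remove a pivot pair of one unknown and one
  equation.\<close>

lemma square_system_solvable:
  fixes L :: "('a \<Rightarrow> real) \<Rightarrow> 'b \<Rightarrow> real"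
  assumes "finite S" and "finite T" and "card S = card T"
    and lin: "\<And>c x y t. t \<in> T \<Longrightarrow> L (\<lambda>q. c * x q + y q) t = c * L x t + L y t"
    and inj: "\<And>x q. (\<And>t. t \<in> T \<Longrightarrow> L x t = 0) \<Longrightarrow> q \<in> S \<Longrightarrow> x q = 0"
  shows "\<exists>x. \<forall>t\<in>T. L x t = r t"
  using assms
proof (induction S arbitrary: T L r rule: finite_induct)
  case empty
  then show ?case by simp
next
  case (insert s S)
  note lin = insert.prems(3) and inj = insert.prems(4)
  define \<delta> where "\<delta> = (\<lambda>q. if q = s then 1 else (0::real))"
  \<comment> \<open>A pivot exists: if every equation vanished on \<open>\<delta>\<close>,
    injectivity would force \<open>\<delta> s = 0\<close>.\<close>
  obtain t0 where t0: "t0 \<in> T" "L \<delta> t0 \<noteq> 0"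
    using inj[of \<delta> s] by (auto simp: \<delta>_def)
  \<comment> \<open>Solve equation \<open>t0\<close> for the unknown \<open>s\<close> and substitute into the others.\<close>
  define c where "c x = - L x t0 / L \<delta> t0" for x
  define L' where "L' x t = L (\<lambda>q. c x * \<delta> q + x q) t" for x t
  have L': "L' x t = c x * L \<delta> t + L x t" if "t \<in> T" for x t
    using lin[OF that] by (simp add: L'_def)
  have L'_t0: "L' x t0 = 0" for x
    using L'[OF t0(1)] t0(2) by (simp add: c_def)
  \<comment> \<open>Equation \<open>t0\<close> demands adding
    \<open>(c x + r t0 / L \<delta> t0) * \<delta> q\<close> to \<open>x q\<close>; the contribution
    that does not depend on \<open>x\<close> is moved to the right-hand side.\<close>
  have "\<exists>x. \<forall>t\<in>T - {t0}. L' x t = r t - r t0 / L \<delta> t0 * L \<delta> t"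
  proof (rule insert.IH)
    show "finite (T - {t0})" using insert.prems(1) by simp
    show "card S = card (T - {t0})"
      using insert.prems(1,2) insert.hyps t0(1) by simp
    show "L' (\<lambda>q. d * x q + y q) t = d * L' x t + L' y t" if "t \<in> T - {t0}" for d x y t
      using that lin[OF t0(1), of d x y] lin[of t d x y] t0(2)
      by (simp add: L' c_def field_simps)
    show "x q = 0" if "\<And>t. t \<in> T - {t0} \<Longrightarrow> L' x t = 0" and "q \<in> S" for x q
    proof -
      have "c x * \<delta> q + x q = 0"
        by (rule inj) (use that L'_t0 in \<open>auto simp flip: L'_def\<close>)
      with \<open>q \<in> S\<close> insert.hyps show ?thesis by (auto simp: \<delta>_def split: if_splits)
    qed
  qed
  then obtain x where x: "\<And>t. t \<in> T - {t0} \<Longrightarrow> L' x t = r t - r t0 / L \<delta> t0 * L \<delta> t"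
    by blast
  have "L (\<lambda>q. (c x + r t0 / L \<delta> t0) * \<delta> q + x q) t = r t" if "t \<in> T" for t
    using x[of t] lin[OF that, of "c x + r t0 / L \<delta> t0" \<delta> x] L'[OF that, of x] L'_t0[of x] that t0
    by (cases "t = t0") (auto simp: algebra_simps)
  then show ?case by blast
qed

section \<open>Summation by parts\<close>

text \<open>The flux across the edge between nodes \<open>k\<close> and \<open>Suc k\<close>. The
  outer factor \<open>1 / h\<close> is absorbed, so that \<open>diff_x\<close> and
  \<open>diff_y\<close> are both plain backward differences of fluxes.\<close>

definition flux :: "real \<Rightarrow> (nat \<Rightarrow> real) \<Rightarrow> (nat \<Rightarrow> real) \<Rightarrow> nat \<Rightarrow> real" where
  "flux h c v k = 1 / h * ((c (Suc k) + c k) / 2 * ((v (Suc k) - v k) / h))"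

lemma diff_x_flux:
  "k \<ge> 1 \<Longrightarrow> diff_x h \<epsilon> u k j
     = flux h (\<lambda>i. 1 / \<epsilon> i j) (\<lambda>i. u i j) k - flux h (\<lambda>i. 1 / \<epsilon> i j) (\<lambda>i. u i j) (k - 1)"
  by (simp add: diff_x_def flux_def flip: diff_divide_distrib)

lemma diff_y_flux:
  "k \<ge> 1 \<Longrightarrow> diff_y h \<alpha> u i k = flux h (\<alpha> i) (u i) k - flux h (\<alpha> i) (u i) (k - 1)"
  by (simp add: diff_y_def flux_def flip: diff_divide_distrib)

lemma sum_flux_telescope:
  fixes g :: "nat \<Rightarrow> real"
  shows "(\<Sum>k=1..n. g k - g (k - 1)) = g n - g 0"
  by (induction n) auto

text \<open>Abel summation. The \<open>n\<close> inner nodes touch \<open>n + 1\<close> edges, hence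
  the energy sum from 0 to \<open>n\<close>.\<close>

lemma sum_by_parts:
  fixes v g :: "nat \<Rightarrow> real"
  shows "(\<Sum>k=1..n. v k * (g k - g (k - 1)))
           = v (n + 1) * g n - v 0 * g 0 - (\<Sum>k\<le>n. g k * (v (Suc k) - v k))"
  by (induction n) (auto simp: algebra_simps)

lemma flux_energy_nonneg:
  assumes "c (Suc k) > 0" and "c k > 0"
  shows "flux h c v k * (v (Suc k) - v k) \<ge> 0"
proof -
  have "flux h c v k * (v (Suc k) - v k) = (c (Suc k) + c k) / 2 * (v (Suc k) - v k)\<^sup>2 / h\<^sup>2"
    by (simp add: flux_def power2_eq_square)
  with assms show ?thesis by simp
qed

text \<open>After summation by parts only minus an energy is left. The boundary hypotheses are
  products so as to cover both directions: in \<open>y\<close> the values vanish at the ends, in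
  \<open>x\<close> the fluxes do.\<close>

lemma sum_flux_diff_nonpos:
  assumes "\<And>k. k \<le> n + 1 \<Longrightarrow> c k > 0"
    and "v (n + 1) * flux h c v n = 0" and "v 0 * flux h c v 0 = 0"
  shows "(\<Sum>k=1..n. v k * (flux h c v k - flux h c v (k - 1))) \<le> 0"
  unfolding sum_by_parts using assms
  by (auto intro!: sum_nonneg flux_energy_nonneg)

text \<open>The equality case: each energy term vanishes, so by positivity of \<open>c\<close> all
  increments of \<open>v\<close> vanish and \<open>v\<close> keeps its value 0 from the left
  end.\<close>

lemma flux_diff_sum_eq_0_imp_zero:
  assumes "h \<noteq> 0" and c: "\<And>k. k \<le> n + 1 \<Longrightarrow> c k > 0"
    and "v 0 = 0" and "v (n + 1) = 0"
    and "(\<Sum>k=1..n. v k * (flux h c v k - flux h c v (k - 1))) = 0"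
    and "k \<le> n + 1"
  shows "v k = 0"
proof -
  have "(\<Sum>k\<le>n. flux h c v k * (v (Suc k) - v k)) = 0"
    using assms sum_by_parts[of v "flux h c v" n] by simp
  then have "\<forall>k\<in>{..n}. flux h c v k * (v (Suc k) - v k) = 0"
    by (subst (asm) sum_nonneg_eq_0_iff) (auto intro!: flux_energy_nonneg c)
  then have step: "v (Suc k) = v k" if "k \<le> n" for k
  proof -
    have "c (Suc k) + c k > 0"
      using that c[of k] c[of "Suc k"] by simp
    moreover have "flux h c v k * (v (Suc k) - v k) = 0"
      using that \<open>\<forall>k\<in>{..n}. flux h c v k * (v (Suc k) - v k) = 0\<close> by simp
    ultimately show ?thesis
      using \<open>h \<noteq> 0\<close> by (simp add: flux_def)
  qed
  show ?thesis
    using \<open>k \<le> n + 1\<close> by (induction k) (use \<open>v 0 = 0\<close> step in auto)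
qed

section \<open>The scheme\<close>

text \<open>Each column sum is minus an energy, thus at most 0 by the Dirichlet conditions; a
  nonnegative total makes every one of them 0. Both cases of \<epsilon> end here, differing only in
  how they obtain the sign of the total.\<close>

lemma zero_if_y_energy_nonneg:
  assumes "J \<ge> 2" and "hy \<noteq> 0"
    and \<alpha>: "\<And>i j. i \<le> I \<Longrightarrow> j \<le> J \<Longrightarrow> \<alpha> i j > 0"
    and bd: "\<And>i. i \<le> I \<Longrightarrow> u i 0 = 0" "\<And>i. i \<le> I \<Longrightarrow> u i J = 0"
    and nonneg: "(\<Sum>i=1..I-1. \<Sum>j=1..J-1. u i j * diff_y hy \<alpha> u i j) \<ge> 0"
    and i: "i \<in> {1..I-1}" and j: "j \<le> J"
  shows "u i j = 0"
proof -
  define e where "e i = (\<Sum>j=1..J-1. u i j * (flux hy (\<alpha> i) (u i) j - flux hy (\<alpha> i) (u i) (j - 1)))"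
    for i
  have "e i \<le> 0" if "i \<in> {1..I-1}" for i
    unfolding e_def by (rule sum_flux_diff_nonpos) (use that \<alpha> bd \<open>J \<ge> 2\<close> in auto)
  moreover have "(\<Sum>i=1..I-1. e i) \<ge> 0"
    using nonneg by (simp add: e_def diff_y_flux)
  ultimately have "e i = 0"
    using sum_nonneg_eq_0_iff[of "{1..I-1}" "\<lambda>i. - e i"] sum_nonneg[of "{1..I-1}" "\<lambda>i. - e i"] i
    by (simp add: sum_negf)
  then show ?thesis
    unfolding e_def
    by (rule flux_diff_sum_eq_0_imp_zero[of hy "J - 1" "\<alpha> i" "u i", rotated 4])
       (use \<alpha> bd \<open>hy \<noteq> 0\<close> \<open>J \<ge> 2\<close> i j in auto)
qed

lemma homogeneous_zero_pos:
  assumes "I \<ge> 2" and "J \<ge> 2" and "hx \<noteq> 0" and "hy \<noteq> 0"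
    and \<alpha>: "\<And>i j. i \<le> I \<Longrightarrow> j \<le> J \<Longrightarrow> \<alpha> i j > 0"
    and \<epsilon>: "\<And>i j. i \<le> I \<Longrightarrow> j \<le> J \<Longrightarrow> \<epsilon> i j > 0"
    and sys: "solves_system I J hy \<alpha> (\<lambda>_ _. 0) (int_eq hx hy \<alpha> (\<lambda>_ _. 0) \<epsilon>) u"
    and "i \<le> I" and j: "j \<le> J"
  shows "u i j = 0"
proof -
  define g where "g j = flux hx (\<lambda>i. 1 / \<epsilon> i j) (\<lambda>i. u i j)" for j
  have bd: "u i 0 = 0" "u i J = 0" if "i \<le> I" for i
    using sys that by (auto simp: solves_system_def)
  have left: "u 0 j = u 1 j" if "j \<in> {1..J-1}" for j
    using sys that by (auto simp: solves_system_def)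
  have int: "diff_y hy \<alpha> u i j = - (g j i - g j (i - 1))" if "i \<in> {1..I-1}" "j \<in> {1..J-1}" for i j
  proof -
    have "- diff_x hx \<epsilon> u i j - diff_y hy \<alpha> u i j = 0"
      using sys that unfolding solves_system_def int_eq_def by blast
    then show ?thesis using that by (simp add: diff_x_flux g_def)
  qed
  have g_first: "g j 0 = 0" if "j \<in> {1..J-1}" for j
    using left[OF that] by (simp add: g_def flux_def)
  \<comment> \<open>The right boundary equation becomes the missing Neumann condition: the row sum
    of \<open>diff_y\<close> telescopes through the interior equations to the last flux.\<close>
  have g_last: "g j (I - 1) = 0" if "j \<in> {1..J-1}" for j
  proof -
    have "0 = - (\<Sum>i=1..I-1. diff_y hy \<alpha> u i j)"
      using sys that by (simp add: solves_system_def)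
    also have "\<dots> = (\<Sum>i=1..I-1. g j i - g j (i - 1))"
      using int that by (simp flip: sum_negf)
    also have "\<dots> = g j (I - 1)"
      using g_first[OF that] by (simp only: sum_flux_telescope diff_0_right)
    finally show ?thesis by simp
  qed
  have right: "u I j = u (I - 1) j" if "j \<in> {1..J-1}" for j
  proof -
    have "1 / \<epsilon> I j + 1 / \<epsilon> (I - 1) j > 0"
      using that \<epsilon>[of I j] \<epsilon>[of "I - 1" j] by (intro add_pos_pos) auto
    then show ?thesis
      using g_last[OF that] \<open>hx \<noteq> 0\<close> \<open>I \<ge> 2\<close> by (auto simp: g_def flux_def)
  qed
  \<comment> \<open>The boundary terms vanish here because the end fluxes do; nothing is known yet
    about \<open>u 0 j\<close> and \<open>u I j\<close>.\<close>
  have "(\<Sum>i=1..I-1. u i j * (g j i - g j (i - 1))) \<le> 0" if "j \<in> {1..J-1}" for j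
    unfolding g_def
    by (rule sum_flux_diff_nonpos)
       (use that \<epsilon> \<open>I \<ge> 2\<close> g_first g_last in \<open>auto simp flip: g_def\<close>)
  then have "(\<Sum>j=1..J-1. \<Sum>i=1..I-1. u i j * (g j i - g j (i - 1))) \<le> 0"
    by (rule sum_nonpos)
  moreover have "(\<Sum>i=1..I-1. \<Sum>j=1..J-1. u i j * diff_y hy \<alpha> u i j)
      = - (\<Sum>j=1..J-1. \<Sum>i=1..I-1. u i j * (g j i - g j (i - 1)))"
    by (subst sum.swap) (simp add: int right_diff_distrib flip: sum_negf)
  ultimately have nonneg: "(\<Sum>i=1..I-1. \<Sum>j=1..J-1. u i j * diff_y hy \<alpha> u i j) \<ge> 0"
    by simp
  have interior: "u i j = 0" if "i \<in> {1..I-1}" "j \<le> J" for i j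
    by (rule zero_if_y_energy_nonneg[OF \<open>J \<ge> 2\<close> \<open>hy \<noteq> 0\<close> _ _ _ nonneg]) (use \<alpha> bd that in auto)
  consider "j = 0" | "j = J" | "j \<in> {1..J-1}" using j by fastforce
  then show ?thesis
  proof cases
    case 3
    \<comment> \<open>The outer columns copy their interior neighbours through \<open>left\<close>
      and \<open>right\<close>.\<close>
    consider "i = 0" | "i = I" | "i \<in> {1..I-1}" using \<open>i \<le> I\<close> by fastforce
    then show ?thesis
      using interior[of _ j] left[OF 3] right[OF 3] 3 \<open>I \<ge> 2\<close> by cases auto
  qed (use bd \<open>i \<le> I\<close> in auto)
qed

lemma homogeneous_zero_limit:
  assumes "I \<ge> 2" and "J \<ge> 2" and "hy \<noteq> 0"
    and \<alpha>: "\<And>i j. i \<le> I \<Longrightarrow> j \<le> J \<Longrightarrow> \<alpha> i j > 0"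
    and sys: "solves_system I J hy \<alpha> (\<lambda>_ _. 0) int_eq_zero u"
    and "i \<le> I" and j: "j \<le> J"
  shows "u i j = 0"
proof -
  have bd: "u i 0 = 0" "u i J = 0" if "i \<le> I" for i
    using sys that by (auto simp: solves_system_def)
  have const: "u i j = u 0 j" if "i \<le> I" "j \<in> {1..J-1}" for i j
  proof -
    \<comment> \<open>The left boundary equation starts the induction, and the limit equation
      carries the zero increment on to the right.\<close>
    have step: "u (k + 1) j = u k j" if "k < I" for k
      using that
    proof (induction k)
      case 0
      then show ?case using sys \<open>j \<in> {1..J-1}\<close> by (simp add: solves_system_def)
    next
      case (Suc k)
      have "int_eq_zero u (Suc k) j"
        using sys Suc.prems \<open>j \<in> {1..J-1}\<close> by (simp add: solves_system_def)
      with Suc show ?case by (simp add: int_eq_zero_def)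
    qed
    show ?thesis using \<open>i \<le> I\<close> by (induction i) (use step in auto)
  qed
  have "(\<Sum>i=1..I-1. u i j * diff_y hy \<alpha> u i j) = 0" if "j \<in> {1..J-1}" for j
  proof -
    \<comment> \<open>A constant row lets the test factor leave the sum, and what remains is the
      right boundary equation.\<close>
    have "(\<Sum>i=1..I-1. u i j * diff_y hy \<alpha> u i j) = (\<Sum>i=1..I-1. u 0 j * diff_y hy \<alpha> u i j)"
      by (intro sum.cong refl arg_cong2[where f = "(*)"] const) (use that in auto)
    also have "\<dots> = u 0 j * (\<Sum>i=1..I-1. diff_y hy \<alpha> u i j)"
      by (rule sum_distrib_left[symmetric])
    also have "\<dots> = 0"
      using sys that by (simp add: solves_system_def)
    finally show ?thesis .
  qed
  then have "(\<Sum>j=1..J-1. \<Sum>i=1..I-1. u i j * diff_y hy \<alpha> u i j) = 0"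
    by (rule sum.neutral[OF ballI])
  then have nonneg: "(\<Sum>i=1..I-1. \<Sum>j=1..J-1. u i j * diff_y hy \<alpha> u i j) \<ge> 0"
    by (subst sum.swap) simp
  have interior: "u 1 j = 0" if "j \<le> J" for j
    by (rule zero_if_y_energy_nonneg[OF \<open>J \<ge> 2\<close> \<open>hy \<noteq> 0\<close> _ _ _ nonneg])
       (use \<alpha> bd that \<open>I \<ge> 2\<close> in auto)
  consider "j = 0" | "j = J" | "j \<in> {1..J-1}" using j by fastforce
  then show ?thesis
  proof cases
    case 3
    with const[of i j] const[of 1 j] interior[OF j] \<open>i \<le> I\<close> \<open>I \<ge> 2\<close> show ?thesis by simp
  qed (use bd \<open>i \<le> I\<close> in auto)
qed

section \<open>From trivial kernel to unique solvability\<close>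

lemma flux_diff_linear:
  fixes h p q c :: real
  shows "1 / h * (p * ((c * x' + y' - (c * x + y)) / h) - q * ((c * x + y - (c * z + w)) / h))
    = c * (1 / h * (p * ((x' - x) / h) - q * ((x - z) / h)))
      + 1 / h * (p * ((y' - y) / h) - q * ((y - w) / h))"
  unfolding divide_inverse by algebra

lemma diff_x_linear:
  "diff_x h \<epsilon> (\<lambda>i j. c * u i j + v i j) i j = c * diff_x h \<epsilon> u i j + diff_x h \<epsilon> v i j"
  unfolding diff_x_def by (rule flux_diff_linear)

lemma diff_y_linear:
  "diff_y h \<alpha> (\<lambda>i j. c * u i j + v i j) i j = c * diff_y h \<alpha> u i j + diff_y h \<alpha> v i j"
  unfolding diff_y_def by (rule flux_diff_linear)

lemma diff_y_cong:
  assumes "\<And>k. k \<le> j + 1 \<Longrightarrow> u i k = v i k"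
  shows "diff_y h \<alpha> u i j = diff_y h \<alpha> v i j"
  using assms by (simp add: diff_y_def)

text \<open>The interior operator \<open>A\<close> is abstract so that both cases share the
  argument. \<open>A_cong\<close> says that \<open>A\<close> sees grid values only, which permits
  passing from an arbitrary function to an extensional one.\<close>

lemma solves_system_unique:
  fixes A :: "(nat \<Rightarrow> nat \<Rightarrow> real) \<Rightarrow> nat \<Rightarrow> nat \<Rightarrow> real"
  assumes "I \<ge> 2" and "J \<ge> 2"
    and A_linear: "\<And>c u v i j. A (\<lambda>i j. c * u i j + v i j) i j = c * A u i j + A v i j"
    and A_cong: "\<And>u v i j. i \<in> {1..I-1} \<Longrightarrow> j \<in> {1..J-1} \<Longrightarrow>
      (\<And>k l. k \<le> I \<Longrightarrow> l \<le> J \<Longrightarrow> u k l = v k l) \<Longrightarrow> A u i j = A v i j"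
    and zero: "\<And>u i j. solves_system I J hy \<alpha> (\<lambda>_ _. 0) (\<lambda>u i j. A u i j = 0) u
      \<Longrightarrow> i \<le> I \<Longrightarrow> j \<le> J \<Longrightarrow> u i j = 0"
  shows "\<exists>!u. u \<in> grid_funs I J \<and> solves_system I J hy \<alpha> f (\<lambda>u i j. A u i j = r i j) u"
proof -
  define S where "S = {..I} \<times> {..J}"
  \<comment> \<open>The equation attached to each grid point; the corners carry Dirichlet conditions.\<close>
  define L where "L x = (\<lambda>(i, j). if j = 0 \<or> j = J then x (i, j)
      else if i = 0 then x (0, j) - x (1, j)
      else if i = I then - (\<Sum>k=1..I-1. diff_y hy \<alpha> (curry x) k j)
      else A (curry x) i j)" for x
  \<comment> \<open>The data \<open>g\<close> of the right boundary and \<open>s\<close> of the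
    interior are kept apart: in the limiting case \<open>s\<close> is 0 while \<open>g\<close> is
    still \<open>f\<close>.\<close>
  define R where "R g s = (\<lambda>(i, j). if j = 0 \<or> j = J \<or> i = 0 then 0
      else if i = I then \<Sum>k=1..I-1. g k j else s i j)" for g s :: "nat \<Rightarrow> nat \<Rightarrow> real"
  have sys_iff: "solves_system I J hy \<alpha> g (\<lambda>u i j. A u i j = s i j) (curry x)
      \<longleftrightarrow> (\<forall>t\<in>S. L x t = R g s t)" for g s x
  proof
    assume "solves_system I J hy \<alpha> g (\<lambda>u i j. A u i j = s i j) (curry x)"
    then show "\<forall>t\<in>S. L x t = R g s t"
      by (auto simp: solves_system_def S_def L_def R_def)
  next
    assume *: "\<forall>t\<in>S. L x t = R g s t"
    have j: "j \<noteq> 0" "j \<noteq> J" "j \<le> J" if "j \<in> {1..J-1}" for j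
      using that by auto
    have "A (curry x) i j = s i j" if "i \<in> {1..I-1}" "j \<in> {1..J-1}" for i j
    proof -
      have "i \<noteq> 0" "i \<noteq> I" "i \<le> I" using that by auto
      then show ?thesis
        using *[rule_format, of "(i, j)"] j[OF that(2)] by (simp add: S_def L_def R_def)
    qed
    moreover have "x (0, j) - x (1, j) = 0" if "j \<in> {1..J-1}" for j
      using *[rule_format, of "(0, j)"] j[OF that] by (simp add: S_def L_def R_def)
    moreover have "- (\<Sum>k=1..I-1. diff_y hy \<alpha> (curry x) k j) = (\<Sum>k=1..I-1. g k j)"
      if "j \<in> {1..J-1}" for j
      using *[rule_format, of "(I, j)"] j[OF that] \<open>I \<ge> 2\<close> by (simp add: S_def L_def R_def)
    moreover have "x (i, 0) = 0 \<and> x (i, J) = 0" if "i \<le> I" for i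
      using *[rule_format, of "(i, 0)"] *[rule_format, of "(i, J)"] that
      by (auto simp: S_def L_def R_def)
    ultimately show "solves_system I J hy \<alpha> g (\<lambda>u i j. A u i j = s i j) (curry x)"
      by (simp add: solves_system_def)
  qed
  have L_linear: "L (\<lambda>q. c * x q + y q) t = c * L x t + L y t" for c x y t
  proof -
    have eq: "curry (\<lambda>q. c * x q + y q) = (\<lambda>i j. c * curry x i j + curry y i j)"
      by (simp add: curry_def)
    show ?thesis
      unfolding L_def eq A_linear diff_y_linear sum.distrib sum_distrib_left[symmetric]
      by (simp add: algebra_simps split: prod.split)
  qed
  have L_inj: "x q = 0" if "\<And>t. t \<in> S \<Longrightarrow> L x t = 0" "q \<in> S" for x q
  proof -
    have "R (\<lambda>_ _. 0) (\<lambda>_ _. 0) = (\<lambda>_. 0)" by (auto simp: R_def)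
    then have "solves_system I J hy \<alpha> (\<lambda>_ _. 0) (\<lambda>u i j. A u i j = 0) (curry x)"
      using sys_iff[of "\<lambda>_ _. 0" "\<lambda>_ _. 0" x] that(1) by simp
    from zero[OF this, of "fst q" "snd q"] that(2) show ?thesis by (auto simp: S_def)
  qed
  have L_cong: "L x t = L y t" if "\<And>q. q \<in> S \<Longrightarrow> x q = y q" "t \<in> S" for x y t
  proof -
    have eq: "curry x k l = curry y k l" if "k \<le> I" "l \<le> J" for k l
      using that \<open>\<And>q. q \<in> S \<Longrightarrow> x q = y q\<close> by (simp add: S_def)
    obtain i j where t: "t = (i, j)" "i \<le> I" "j \<le> J" using \<open>t \<in> S\<close> by (auto simp: S_def)
    consider "j = 0 \<or> j = J" | "j \<in> {1..J-1}" "i = 0" | "j \<in> {1..J-1}" "i = I"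
      | "j \<in> {1..J-1}" "i \<in> {1..I-1}"
      using t by fastforce
    then show ?thesis
    proof cases
      case 3
      then have "diff_y hy \<alpha> (curry x) k j = diff_y hy \<alpha> (curry y) k j" if "k \<in> {1..I-1}" for k
        using that by (intro diff_y_cong eq) auto
      then show ?thesis using 3 t \<open>I \<ge> 2\<close> by (auto simp: L_def)
    next
      case 4
      then have "A (curry x) i j = A (curry y) i j" by (intro A_cong eq) auto
      then show ?thesis using 4 t by (auto simp: L_def)
    qed (use t eq[of i j] eq[of 0 j] eq[of 1 j] \<open>I \<ge> 2\<close> in \<open>auto simp: L_def\<close>)
  qed
  have "\<exists>x. \<forall>t\<in>S. L x t = R f r t"
    by (rule square_system_solvable[of S S]) (use L_linear L_inj in \<open>auto simp: S_def\<close>)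
  then obtain x where x: "\<And>t. t \<in> S \<Longrightarrow> L x t = R f r t" by blast
  \<comment> \<open>Elimination says nothing about extensionality, so its solution is cut down to
    the grid; \<open>L_cong\<close> shows that the equations survive.\<close>
  define u where "u = (\<lambda>i\<in>{0..I}. \<lambda>j\<in>{0..J}. x (i, j))"
  show ?thesis
  proof (rule ex1I)
    have "L (case_prod u) t = R f r t" if "t \<in> S" for t
      using L_cong[of "case_prod u" x, OF _ that] x[OF that] by (auto simp: u_def S_def)
    then show "u \<in> grid_funs I J \<and> solves_system I J hy \<alpha> f (\<lambda>u i j. A u i j = r i j) u"
      using sys_iff[of f r "case_prod u"] by (auto simp: u_def grid_funs_def)
  next
    fix v assume v: "v \<in> grid_funs I J \<and> solves_system I J hy \<alpha> f (\<lambda>u i j. A u i j = r i j) v"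
    have Lv: "L (case_prod v) t = R f r t" if "t \<in> S" for t
      using sys_iff[of f r "case_prod v"] v that by simp
    \<comment> \<open>The difference of the two solutions, in the form \<open>c * x q + y q\<close>
      required by linearity.\<close>
    have "L (\<lambda>q. (-1) * x q + case_prod v q) t = 0" if "t \<in> S" for t
      using L_linear[of "-1" x "case_prod v" t] x[OF that] Lv[OF that] by simp
    from L_inj[OF this] have "v i j = x (i, j)" if "i \<le> I" "j \<le> J" for i j
      using that by (force simp: S_def)
    with v show "v = u"
      unfolding u_def grid_funs_def
      by (intro extensionalityI[of _ "{0..I}"] extensionalityI[of _ "{0..J}"])
         (auto simp: PiE_def Pi_def intro!: extensionalityI[of _ "{0..J}"])
  qed
qed

theorem theorem3p1:
  fixes I J :: nat and a b hx hy :: real and \<alpha> f :: "nat \<Rightarrow> nat \<Rightarrow> real"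
  assumes "I \<ge> 2" and "J \<ge> 2"
    and "a > 0" and "b > 0"
    and "hx = a / real I" and "hy = b / real J"
    and "\<And>i j. i \<le> I \<Longrightarrow> j \<le> J \<Longrightarrow> \<alpha> i j > 0"
  shows "(\<forall>\<epsilon> :: nat \<Rightarrow> nat \<Rightarrow> real. (\<forall>i\<le>I. \<forall>j\<le>J. \<epsilon> i j > 0) \<longrightarrow>
            (\<exists>!u. u \<in> grid_funs I J \<and> solves_system I J hy \<alpha> f (int_eq hx hy \<alpha> f \<epsilon>) u)) \<and>
         (\<exists>!u. u \<in> grid_funs I J \<and> solves_system I J hy \<alpha> f int_eq_zero u)"
proof (intro conjI allI impI)
  have hx: "hx \<noteq> 0" and hy: "hy \<noteq> 0" using assms(1-6) by auto
  {
    fix \<epsilon> :: "nat \<Rightarrow> nat \<Rightarrow> real"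
    assume \<epsilon>: "\<forall>i\<le>I. \<forall>j\<le>J. \<epsilon> i j > 0"
    define A where "A u i j = - diff_x hx \<epsilon> u i j - diff_y hy \<alpha> u i j" for u i j
    \<comment> \<open>The source \<open>g\<close> is arbitrary because \<open>f\<close> is needed
      for the goal and 0 for the homogeneous system.\<close>
    have E: "int_eq hx hy \<alpha> g \<epsilon> = (\<lambda>u i j. A u i j = g i j)" for g
      by (simp add: int_eq_def A_def fun_eq_iff)
    show "\<exists>!u. u \<in> grid_funs I J \<and> solves_system I J hy \<alpha> f (int_eq hx hy \<alpha> f \<epsilon>) u"
      unfolding E
    proof (rule solves_system_unique)
      show "A (\<lambda>i j. c * u i j + v i j) i j = c * A u i j + A v i j" for c u v i j
        unfolding A_def diff_x_linear diff_y_linear by (simp add: right_diff_distrib)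
      show "A u i j = A v i j" if "i \<in> {1..I-1}" "j \<in> {1..J-1}"
        "\<And>k l. k \<le> I \<Longrightarrow> l \<le> J \<Longrightarrow> u k l = v k l" for u v i j
      proof -
        have "i + 1 \<le> I" "j + 1 \<le> J" "i \<le> I" "j \<le> J" "i - 1 \<le> I" "j - 1 \<le> J"
          using that by auto
        then show ?thesis by (simp add: A_def diff_x_def diff_y_def that(3) del: One_nat_def)
      qed
      show "u i j = 0" if "solves_system I J hy \<alpha> (\<lambda>_ _. 0) (\<lambda>u i j. A u i j = 0) u"
        "i \<le> I" "j \<le> J" for u i j
        by (rule homogeneous_zero_pos[OF assms(1,2) hx hy, where \<alpha> = \<alpha> and \<epsilon> = \<epsilon>])
           (use assms(7) \<epsilon> that in \<open>simp_all add: E\<close>)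
    qed (use assms in auto)
  }
  define A :: "(nat \<Rightarrow> nat \<Rightarrow> real) \<Rightarrow> nat \<Rightarrow> nat \<Rightarrow> real"
    where "A u i j = (u (i + 1) j - u i j) - (u i j - u (i - 1) j)" for u i j
  have E: "int_eq_zero = (\<lambda>u i j. A u i j = 0)"
    by (simp only: fun_eq_iff int_eq_zero_def A_def right_minus_eq simp_thms)
  show "\<exists>!u. u \<in> grid_funs I J \<and> solves_system I J hy \<alpha> f int_eq_zero u"
    unfolding E
  proof (rule solves_system_unique)
    show "A (\<lambda>i j. c * u i j + v i j) i j = c * A u i j + A v i j" for c u v i j
      by (simp add: A_def algebra_simps)
    show "A u i j = A v i j" if "i \<in> {1..I-1}" "j \<in> {1..J-1}"
      "\<And>k l. k \<le> I \<Longrightarrow> l \<le> J \<Longrightarrow> u k l = v k l" for u v i j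
    proof -
      have "i + 1 \<le> I" "j \<le> J" "i \<le> I" "i - 1 \<le> I"
        using that by auto
      then show ?thesis by (simp add: A_def that(3) del: One_nat_def)
    qed
    show "u i j = 0" if "solves_system I J hy \<alpha> (\<lambda>_ _. 0) (\<lambda>u i j. A u i j = 0) u"
      "i \<le> I" "j \<le> J" for u i j
      by (rule homogeneous_zero_limit[OF assms(1,2) hy, where \<alpha> = \<alpha>])
         (use assms(7) that in \<open>simp_all add: E\<close>)
  qed (use assms in auto)
qed

end
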